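(* The tournament $P_7$ does not have the strong EH-property.
   Context: A tournament is a finite loopless digraph such that for every pair $u,v$ of distinct vertices exactly one of $uv,vu$ is an edge; an edge $uv$ is directed from $u$ to $v$. A tournament $G$ is $H$-free if no subtournament of $G$ is isomorphic to $H$. $|G|$ denotes the number of vertices. A pure pair in a tournament $G$ is an ordered pair $(A,B)$ of disjoint subsets of $V(G)$ such that $ab\in E(G)$ for all $a\in A,b\in B$; its order is $\min(|A|,|B|)$. A tournament $H$ has the strong EH-property if there exists $c>0$ such that for every $H$-free tournament $G$ with $|G|>1$, there is a pure pair in $G$ of order at least $c|G|$. $P_7$ is the Paley tournament with vertex set $\{1,\dots,7\}$ in which, for distinct $i,j$, there is an edge from $i$ to $j$ if and only if $j-i$ is congruent to $1$, $2$ or $4$ modulo $7$. *)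

theory Defs
  imports Graph_Theory.Graph_Theory "HOL-Number_Theory.Cong"
begin

locale tournament = pair_digraph T for T :: "'a pair_pre_digraph" +
  assumes exactly_one_arc:
    "\<lbrakk>u \<in> pverts T; v \<in> pverts T; u \<noteq> v\<rbrakk> \<Longrightarrow> ((u, v) \<in> parcs T) \<noteq> ((v, u) \<in> parcs T)"

text \<open>Subtournaments of a tournament are exactly its induced subgraphs.\<close>

definition free_of :: "'a pair_pre_digraph \<Rightarrow> 'b pair_pre_digraph \<Rightarrow> bool" where
  "free_of H G \<longleftrightarrow>
    \<not> (\<exists>K. induced_subgraph K (with_proj G) \<and> digraph_iso K (with_proj H))"

definition pure_pair :: "'a pair_pre_digraph \<Rightarrow> 'a set \<Rightarrow> 'a set \<Rightarrow> bool" where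
  "pure_pair G A B \<longleftrightarrow>
    A \<subseteq> pverts G \<and> B \<subseteq> pverts G \<and> A \<inter> B = {} \<and> (\<forall>a\<in>A. \<forall>b\<in>B. (a, b) \<in> parcs G)"

definition pair_order :: "'a set \<Rightarrow> 'a set \<Rightarrow> nat" where
  "pair_order A B = min (card A) (card B)"

text \<open>
  A definition cannot quantify over the vertex type of \<open>G\<close>; vertices are taken to be
  natural numbers. Nothing is lost, since tournaments are finite: see
  \<open>strong_EH_any_type\<close> below.
\<close>

definition strong_EH :: "'a pair_pre_digraph \<Rightarrow> bool" where
  "strong_EH H \<longleftrightarrow>
    (\<exists>c::real. c > 0 \<and>
      (\<forall>G :: nat pair_pre_digraph.
        tournament G \<and> free_of H G \<and> card (pverts G) > 1 \<longrightarrow>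
        (\<exists>A B. pure_pair G A B \<and> real (pair_order A B) \<ge> c * real (card (pverts G)))))"

definition P7 :: "int pair_pre_digraph" where
  "P7 = \<lparr> pverts = {1..7},
          parcs = {(i, j). i \<in> {1..7} \<and> j \<in> {1..7} \<and> i \<noteq> j \<and>
                     ([j - i = 1] (mod 7) \<or> [j - i = 2] (mod 7) \<or> [j - i = 4] (mod 7))} \<rparr>"

lemma tournament_P7: "tournament P7"
proof
  show "finite (pverts P7)"
    by (simp add: P7_def)
  show "finite (parcs P7)"
    by (rule finite_subset[of _ "{1..7} \<times> {1..7}"]) (auto simp: P7_def)
next
  fix u v assume "u \<in> pverts P7" "v \<in> pverts P7" "u \<noteq> v"
  then show "((u, v) \<in> parcs P7) \<noteq> ((v, u) \<in> parcs P7)"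
    unfolding P7_def cong_def by simp presburger
qed (auto simp: P7_def)

lemma strong_EH_any_type:
  fixes H :: "'a pair_pre_digraph"
  assumes "strong_EH H"
  obtains c :: real where "c > 0"
    and "\<And>G :: 'v pair_pre_digraph. tournament G \<Longrightarrow> free_of H G \<Longrightarrow> card (pverts G) > 1 \<Longrightarrow>
           \<exists>A B. pure_pair G A B \<and> real (pair_order A B) \<ge> c * real (card (pverts G))"
proof -
  obtain c :: real where "c > 0" and c: "\<And>G :: nat pair_pre_digraph.
      tournament G \<Longrightarrow> free_of H G \<Longrightarrow> card (pverts G) > 1 \<Longrightarrow>
      \<exists>A B. pure_pair G A B \<and> real (pair_order A B) \<ge> c * real (card (pverts G))"
    using assms unfolding strong_EH_def by blast
  have "\<exists>A B. pure_pair G A B \<and> real (pair_order A B) \<ge> c * real (card (pverts G))"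
    if T: "tournament G" and F: "free_of H G" and G1: "card (pverts G) > 1"
    for G :: "'v pair_pre_digraph"
  proof -
    interpret G: tournament G by fact
    obtain f :: "'v \<Rightarrow> nat" where f: "inj_on f (pverts G)"
      using finite_imp_inj_to_nat_seg[OF G.pair_finite_verts] by blast
    define G' where "G' = \<lparr> pverts = f ` pverts G, parcs = map_prod f f ` parcs G \<rparr>"
    have arc: "(f u, f v) \<in> parcs G' \<longleftrightarrow> (u, v) \<in> parcs G"
      if "u \<in> pverts G" "v \<in> pverts G" for u v
    proof
      assume "(f u, f v) \<in> parcs G'"
      then obtain x y where xy: "(x, y) \<in> parcs G" "f u = f x" "f v = f y"
        by (auto simp: G'_def)
      then have "x \<in> pverts G" "y \<in> pverts G" by (auto dest: G.in_arcsD1 G.in_arcsD2)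
      with xy that f have "u = x" "v = y" by (auto simp: inj_on_eq_iff)
      with xy show "(u, v) \<in> parcs G" by simp
    qed (force simp: G'_def)
    have arcE: "\<exists>u v. e = (f u, f v) \<and> (u, v) \<in> parcs G \<and> u \<in> pverts G \<and> v \<in> pverts G"
      if "e \<in> parcs G'" for e
      using that by (auto simp: G'_def dest: G.in_arcsD1 G.in_arcsD2)
    have T': "tournament G'"
    proof
      fix e assume "e \<in> parcs G'"
      then obtain u v where e: "e = (f u, f v)" "(u, v) \<in> parcs G" "u \<in> pverts G" "v \<in> pverts G"
        using arcE by blast
      show "fst e \<in> pverts G'" "snd e \<in> pverts G'" using e by (auto simp: G'_def)
      show "fst e \<noteq> snd e" using e f G.pair_no_loops[OF e(2)] by (auto simp: inj_on_eq_iff)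
    next
      fix u v assume "u \<in> pverts G'" "v \<in> pverts G'" "u \<noteq> v"
      then obtain x y where "u = f x" "v = f y" "x \<in> pverts G" "y \<in> pverts G" "x \<noteq> y"
        by (auto simp: G'_def)
      then show "((u, v) \<in> parcs G') \<noteq> ((v, u) \<in> parcs G')"
        using G.exactly_one_arc[of x y] by (simp add: arc)
    qed (auto simp: G'_def G.pair_finite_verts G.pair_finite_arcs)
    have "free_of H G'"
      unfolding free_of_def
    proof
      assume "\<exists>K. induced_subgraph K (with_proj G') \<and> digraph_iso K (with_proj H)"
      then obtain K' where K': "induced_subgraph K' (with_proj G')" "digraph_iso K' (with_proj H)"
        by blast
      define S where "S = {u \<in> pverts G. f u \<in> verts K'}"
      define K where "K = with_proj G \<restriction> S"
      have vK: "verts K' = f ` S" and th: "tail K' = fst" "head K' = snd"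
        using K'(1) unfolding induced_subgraph_def subgraph_def compatible_def
        by (auto simp: S_def G'_def)
      have aK': "arcs K' = {e \<in> parcs G'. fst e \<in> verts K' \<and> snd e \<in> verts K'}"
        using K'(1) unfolding induced_subgraph_def subgraph_def compatible_def by auto
      have aK: "arcs K = {e \<in> parcs G. fst e \<in> S \<and> snd e \<in> S}"
        by (simp add: K_def)
      have ind: "induced_subgraph K (with_proj G)"
        unfolding K_def by (rule G.induced_induce) (auto simp: S_def)
      define h where "h = \<lparr> iso_verts = f, iso_arcs = map_prod f f, iso_head = snd, iso_tail = fst \<rparr>"
      have "pre_digraph.digraph_isomorphism K h"
        unfolding pre_digraph.digraph_isomorphism_def
      proof (intro conjI)
        show "wf_digraph K" using ind by (auto simp: induced_subgraph_def subgraph_def)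
        show "inj_on (iso_verts h) (verts K)"
          using f by (auto simp: h_def K_def S_def inj_on_def)
        show "inj_on (iso_arcs h) (arcs K)"
          using f by (auto simp: h_def aK S_def inj_on_def)
      qed (auto simp: h_def K_def)
      moreover have "K' = app_iso h K"
      proof (rule pre_digraph.equality)
        show "arcs K' = arcs (app_iso h K)"
        proof (intro equalityI subsetI)
          fix e assume e: "e \<in> arcs K'"
          then obtain u v where "e = (f u, f v)" "(u, v) \<in> parcs G" "u \<in> pverts G" "v \<in> pverts G"
            using arcE aK' by blast
          with e have "(u, v) \<in> arcs K" by (auto simp: aK aK' S_def)
          with \<open>e = _\<close> show "e \<in> arcs (app_iso h K)" by (force simp: h_def)
        next
          fix e assume "e \<in> arcs (app_iso h K)"
          then show "e \<in> arcs K'" by (auto simp: h_def aK aK' S_def arc)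
        qed
      qed (use vK th in \<open>auto simp: h_def K_def\<close>)
      ultimately have iso: "digraph_iso K K'"
        unfolding digraph_iso_def by blast
      then have "digraph_iso K (with_proj H)"
        using K'(2) by (rule digraph_iso_trans)
      with ind F show False unfolding free_of_def by blast
    qed
    moreover have card: "card (pverts G') = card (pverts G)"
      using f by (simp add: G'_def card_image)
    ultimately obtain A B where AB: "pure_pair G' A B"
      "real (pair_order A B) \<ge> c * real (card (pverts G))"
      using c[of G'] T' G1 by auto
    define A' where "A' = {u \<in> pverts G. f u \<in> A}"
    define B' where "B' = {u \<in> pverts G. f u \<in> B}"
    have im: "A = f ` A'" "B = f ` B'"
      using AB(1) by (auto simp: pure_pair_def A'_def B'_def G'_def)
    have inj: "inj_on f A'" "inj_on f B'"
      using f by (auto simp: A'_def B'_def inj_on_def)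
    have "pure_pair G A' B'"
      using AB(1) arc unfolding pure_pair_def A'_def B'_def by blast
    moreover have "pair_order A B = pair_order A' B'"
      using inj by (simp add: pair_order_def im card_image)
    ultimately show ?thesis using AB(2) by metis
  qed
  with \<open>c > 0\<close> show ?thesis by (rule that)
qed

end

theory Submission
  imports Defs "HOL-Library.FuncSet"
begin

text \<open>
  The arcs of \<open>P7\<close> decompose into seven cyclic triangles, so every linear ordering of \<open>P7\<close> has
  at least seven backward arcs. Take about \<open>K n\<close> random pairs on \<open>n\<close> vertices: only boundedly many
  7-sets are expected to contain seven of them, whereas for large \<open>K\<close> every two sets of at least
  \<open>\<gamma> n\<close> vertices are joined. Delete a vertex from each dense 7-set and let the surviving pairs
  be the backward arcs of a tournament; it is \<open>P7\<close>-free. A large pure pair \<open>(A, B)\<close> contains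
  halves one of which lies entirely before the other in the ordering: if the half of \<open>A\<close> comes
  first, no chosen pair joins the halves, and otherwise \<open>3 + 4\<close> vertices of them span twelve
  backward arcs.
\<close>

section \<open>Counting functions into a set of pairs\<close>

text \<open>Double counting. It trades a sum over random samples for a sum over configurations, each
  of which is then estimated on its own.\<close>

lemma sum_card_swap:
  assumes "finite A" "finite B"
  shows "(\<Sum>a\<in>A. card {b\<in>B. R a b}) = (\<Sum>b\<in>B. card {a\<in>A. R a b})"
proof -
  have "(\<Sum>a\<in>A. card {b\<in>B. R a b}) = (\<Sum>a\<in>A. \<Sum>b\<in>B. of_bool (R a b))"
    using assms by (intro sum.cong refl) (simp add: Int_def)
  also have "\<dots> = (\<Sum>b\<in>B. \<Sum>a\<in>A. of_bool (R a b))"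
    by (rule sum.swap)
  also have "\<dots> = (\<Sum>b\<in>B. card {a\<in>A. R a b})"
    using assms by (intro sum.cong refl) (simp add: Int_def)
  finally show ?thesis .
qed

text \<open>The condition restricts each coordinate separately, so the functions form a product.
  Divided by the number of all functions, the count is the probability that the independent samples
  indexed by \<open>J\<close> all land in \<open>D\<close>.\<close>

lemma card_PiE_image_subset:
  assumes "finite I" "J \<subseteq> I" "D \<subseteq> C"
  shows "card {e \<in> I \<rightarrow>\<^sub>E C. e ` J \<subseteq> D} = card D ^ card J * card C ^ (card I - card J)"
proof -
  have "{e \<in> I \<rightarrow>\<^sub>E C. e ` J \<subseteq> D} = (\<Pi>\<^sub>E i\<in>I. if i \<in> J then D else C)"
    using assms(2,3) by (fastforce simp: PiE_iff extensional_def split: if_splits)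
  then have "card {e \<in> I \<rightarrow>\<^sub>E C. e ` J \<subseteq> D} = (\<Prod>i\<in>I. card (if i \<in> J then D else C))"
    using assms(1) by (simp add: card_PiE)
  also have "\<dots> = (\<Prod>i\<in>I. if i \<in> J then card D else card C)"
    by (intro prod.cong) auto
  also have "\<dots> = card D ^ card J * card C ^ (card I - card J)"
    using assms(1,2) by (simp add: prod.If_cases Int_absorb1 card_Diff_subset finite_subset Diff_eq[symmetric])
  finally show ?thesis .
qed

lemma choose_le_power: "n choose k \<le> n ^ k"
proof (cases "k \<le> n")
  case True
  then show ?thesis by (rule binomial_le_pow)
qed (simp add: binomial_eq_0)

lemma sum_dense_subsets_le:
  fixes n K s :: nat
  assumes "s \<le> K * n"
  defines "V \<equiv> {..<n}" and "I \<equiv> {..<K * n}"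
  shows "(\<Sum>e \<in> I \<rightarrow>\<^sub>E V \<times> V. card {(S, J). S \<subseteq> V \<and> card S = s \<and> J \<subseteq> I \<and> card J = s \<and> e ` J \<subseteq> S \<times> S})
    \<le> (K * s\<^sup>2) ^ s * (n\<^sup>2) ^ (K * n)"
proof -
  define P where "P = {S. S \<subseteq> V \<and> card S = s} \<times> {J. J \<subseteq> I \<and> card J = s}"
  have fin: "finite V" "finite I" by (simp_all add: V_def I_def)
  then have finP: "finite P" by (simp add: P_def)
  have "(\<Sum>e \<in> I \<rightarrow>\<^sub>E V \<times> V. card {(S, J). S \<subseteq> V \<and> card S = s \<and> J \<subseteq> I \<and> card J = s \<and> e ` J \<subseteq> S \<times> S})
      = (\<Sum>e \<in> I \<rightarrow>\<^sub>E V \<times> V. card {p \<in> P. e ` snd p \<subseteq> fst p \<times> fst p})"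
    by (simp add: P_def mem_Times_iff split_beta' conj_ac)
  also have "\<dots> = (\<Sum>p \<in> P. card {e \<in> I \<rightarrow>\<^sub>E V \<times> V. e ` snd p \<subseteq> fst p \<times> fst p})"
    using fin finP by (intro sum_card_swap finite_PiE) auto
  also have "\<dots> = (\<Sum>p \<in> P. (s\<^sup>2) ^ s * (n\<^sup>2) ^ (K * n - s))"
  proof (intro sum.cong refl)
    fix p assume "p \<in> P"
    then have "fst p \<times> fst p \<subseteq> V \<times> V" "snd p \<subseteq> I" "card (fst p) = s" "card (snd p) = s"
      by (auto simp: P_def)
    then show "card {e \<in> I \<rightarrow>\<^sub>E V \<times> V. e ` snd p \<subseteq> fst p \<times> fst p} = (s\<^sup>2) ^ s * (n\<^sup>2) ^ (K * n - s)"
      using fin by (subst card_PiE_image_subset)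
        (simp_all add: card_cartesian_product V_def I_def power2_eq_square)
  qed
  also have "\<dots> = (n choose s) * (K * n choose s) * ((s\<^sup>2) ^ s * (n\<^sup>2) ^ (K * n - s))"
    using fin by (simp add: P_def card_cartesian_product n_subsets V_def I_def)
  also have "\<dots> \<le> n ^ s * (K * n) ^ s * ((s\<^sup>2) ^ s * (n\<^sup>2) ^ (K * n - s))"
    by (intro mult_mono choose_le_power) auto
  also have "\<dots> = (K * s\<^sup>2) ^ s * ((n\<^sup>2) ^ s * (n\<^sup>2) ^ (K * n - s))"
    by (simp add: power_mult_distrib power2_eq_square)
  \<comment> \<open>By \<open>s \<le> K * n\<close> the natural subtraction in the exponent does not
    truncate.\<close>
  also have "(n\<^sup>2) ^ s * (n\<^sup>2) ^ (K * n - s) = (n\<^sup>2) ^ (K * n)"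
    using assms(1) by (simp flip: power_add)
  finally show ?thesis .
qed

text \<open>There are at most \<open>4 ^ n\<close> pairs \<open>(A, B)\<close>, and each of the
  \<open>N\<close> independent samples misses a given large \<open>A \<times> B\<close> with
  probability at most \<open>1 - \<gamma>\<^sup>2\<close>.\<close>

lemma sum_empty_pairs_le:
  fixes n N :: nat and \<gamma> :: real
  assumes "0 < \<gamma>" "\<gamma> \<le> 1"
  defines "V \<equiv> {..<n}" and "I \<equiv> {..<N}"
  shows "real (\<Sum>e \<in> I \<rightarrow>\<^sub>E V \<times> V. card {(A, B). A \<subseteq> V \<and> B \<subseteq> V \<and> \<gamma> * n \<le> card A \<and> \<gamma> * n \<le> card B
            \<and> e ` I \<inter> A \<times> B = {}})
    \<le> 4 ^ n * ((1 - \<gamma>\<^sup>2) * n\<^sup>2) ^ N"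
proof -
  define P where "P = {A \<in> Pow V. \<gamma> * n \<le> card A} \<times> {B \<in> Pow V. \<gamma> * n \<le> card B}"
  have fin: "finite V" "finite I" by (simp_all add: V_def I_def)
  then have finP: "finite P" by (simp add: P_def)
  have bound: "real (card {e \<in> I \<rightarrow>\<^sub>E V \<times> V. e ` I \<inter> fst p \<times> snd p = {}}) \<le> ((1 - \<gamma>\<^sup>2) * n\<^sup>2) ^ N"
    if "p \<in> P" for p
  proof -
    obtain A B where p: "p = (A, B)" by force
    with that have AB: "A \<subseteq> V" "B \<subseteq> V" "\<gamma> * n \<le> card A" "\<gamma> * n \<le> card B"
      by (auto simp: P_def)
    have "{e \<in> I \<rightarrow>\<^sub>E V \<times> V. e ` I \<inter> A \<times> B = {}} = I \<rightarrow>\<^sub>E (V \<times> V - A \<times> B)"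
      by (fastforce simp: PiE_iff)
    then have "card {e \<in> I \<rightarrow>\<^sub>E V \<times> V. e ` I \<inter> A \<times> B = {}} = card (V \<times> V - A \<times> B) ^ N"
      using fin by (simp add: card_PiE) (simp add: I_def)
    moreover have "real (card (V \<times> V - A \<times> B)) \<le> (1 - \<gamma>\<^sup>2) * n\<^sup>2"
    proof -
      have sub: "A \<times> B \<subseteq> V \<times> V" using AB by auto
      have "card (V \<times> V - A \<times> B) = card (V \<times> V) - card (A \<times> B)"
        using sub fin by (intro card_Diff_subset finite_subset[OF sub]) auto
      moreover have "card (A \<times> B) \<le> card (V \<times> V)"
        using sub fin by (intro card_mono) auto
      ultimately have "real (card (V \<times> V - A \<times> B)) = real n * n - real (card A) * card B"
        by (simp add: of_nat_diff card_cartesian_product V_def)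
      moreover have "(\<gamma> * n) * (\<gamma> * n) \<le> real (card A) * card B"
        using AB assms(1) by (intro mult_mono) auto
      ultimately show ?thesis by (simp add: power2_eq_square algebra_simps)
    qed
    ultimately show ?thesis by (simp add: p power_mono)
  qed
  have "(\<Sum>e \<in> I \<rightarrow>\<^sub>E V \<times> V. card {(A, B). A \<subseteq> V \<and> B \<subseteq> V \<and> \<gamma> * n \<le> card A \<and> \<gamma> * n \<le> card B
            \<and> e ` I \<inter> A \<times> B = {}})
      = (\<Sum>e \<in> I \<rightarrow>\<^sub>E V \<times> V. card {p \<in> P. e ` I \<inter> fst p \<times> snd p = {}})"
    by (simp add: P_def mem_Times_iff split_beta' conj_ac)
  also have "\<dots> = (\<Sum>p \<in> P. card {e \<in> I \<rightarrow>\<^sub>E V \<times> V. e ` I \<inter> fst p \<times> snd p = {}})"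
    using fin finP by (intro sum_card_swap finite_PiE) auto
  also have "real \<dots> \<le> real (card P) * ((1 - \<gamma>\<^sup>2) * n\<^sup>2) ^ N"
    using sum_bounded_above[of P "\<lambda>p. real (card {e \<in> I \<rightarrow>\<^sub>E V \<times> V. e ` I \<inter> fst p \<times> snd p = {}})", OF bound]
    by simp
  also have "\<dots> \<le> 4 ^ n * ((1 - \<gamma>\<^sup>2) * n\<^sup>2) ^ N"
  proof (rule mult_right_mono)
    have "card P \<le> card (Pow V \<times> Pow V)"
      using fin by (intro card_mono) (auto simp: P_def)
    also have "\<dots> = 4 ^ n"
      by (simp add: card_cartesian_product card_Pow V_def flip: power_mult_distrib)
    finally have "real (card P) \<le> real (4 ^ n)"
      by (rule of_nat_mono)
    then show "real (card P) \<le> 4 ^ n" by simp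
    show "0 \<le> ((1 - \<gamma>\<^sup>2) * n\<^sup>2) ^ N"
      using assms(1,2) by (simp add: power_le_one)
  qed
  finally show ?thesis .
qed

text \<open>The order of choices matters: \<open>K\<close> depends only on \<gamma>, then
  \<open>L\<close> bounds the average number of dense sets for every large \<open>n\<close>, and
  finally \<open>n\<close> is taken so large that the average number of unjoined pairs drops below
  \<open>1 / (L + 1)\<close>. Some sample is then good in both respects.\<close>

lemma exists_sparse_pairs:
  fixes \<gamma> :: real and s :: nat
  assumes "0 < \<gamma>" "\<gamma> \<le> 1"
  obtains L n0 :: nat where "\<And>n. n0 \<le> n \<Longrightarrow> \<exists>E \<subseteq> {..<n} \<times> {..<n}.
      card {S. S \<subseteq> {..<n} \<and> card S = s \<and> s \<le> card (E \<inter> S \<times> S)} \<le> L \<and>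
      (\<forall>A B. A \<subseteq> {..<n} \<and> B \<subseteq> {..<n} \<and> \<gamma> * n \<le> card A \<and> \<gamma> * n \<le> card B \<longrightarrow> E \<inter> A \<times> B \<noteq> {})"
proof -
  have "0 < \<gamma>\<^sup>2" "\<gamma>\<^sup>2 \<le> 1" using assms by (simp_all add: power_le_one)
  \<comment> \<open>With \<open>1 / 8\<close>, each vertex contributes a factor of at most
    \<open>4 / 8\<close> to the estimate for unjoined pairs, which beats the \<open>4 ^ n\<close>
    choices of \<open>(A, B)\<close>.\<close>
  then obtain K0 where K0: "(1 - \<gamma>\<^sup>2) ^ K0 < 1 / 8"
    using real_arch_pow_inv[of "1 / 8" "1 - \<gamma>\<^sup>2"] by auto
  \<comment> \<open>The successor makes \<open>K\<close> visibly positive, so that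
    \<open>s \<le> n\<close> yields \<open>s \<le> K * n\<close>.\<close>
  define K where "K = Suc K0"
  have "(1 - \<gamma>\<^sup>2) ^ K \<le> (1 - \<gamma>\<^sup>2) ^ K0"
    unfolding K_def using \<open>0 < \<gamma>\<^sup>2\<close> \<open>\<gamma>\<^sup>2 \<le> 1\<close> by (intro power_decreasing) auto
  with K0 have K: "4 * (1 - \<gamma>\<^sup>2) ^ K \<le> 1 / 2" by simp
  define L where "L = (K * s\<^sup>2) ^ s"
  obtain n1 where n1: "(1 / 2 :: real) ^ n1 < 1 / (L + 1)"
    using real_arch_pow_inv[of "1 / (real L + 1)" "1 / 2"] by (auto simp: add.commute)
  show thesis
  proof (rule that[of "Max {n1, s, 1}" L])
    fix n assume n: "Max {n1, s, 1} \<le> n"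
    define V where "V = {..<n}"
    define I where "I = {..<K * n}"
    define \<Omega> where "\<Omega> = I \<rightarrow>\<^sub>E V \<times> V"
    define M where "M = (n\<^sup>2) ^ (K * n)"
    \<comment> \<open>Witnesses are index sets \<open>J\<close> rather than sets of pairs, which
      keeps the samples independent. A dense \<open>S\<close> may be counted several times, so
      \<open>W e\<close> only overestimates.\<close>
    define W where "W e = card {(S, J). S \<subseteq> V \<and> card S = s \<and> J \<subseteq> I \<and> card J = s \<and> e ` J \<subseteq> S \<times> S}"
      for e :: "nat \<Rightarrow> nat \<times> nat"
    define Z where "Z e = card {(A, B). A \<subseteq> V \<and> B \<subseteq> V \<and> \<gamma> * n \<le> card A \<and> \<gamma> * n \<le> card B
            \<and> e ` I \<inter> A \<times> B = {}}" for e :: "nat \<Rightarrow> nat \<times> nat"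
    have fin: "finite V" "finite I" by (simp_all add: V_def I_def)
    have "M > 0" using n by (simp add: M_def)
    have card: "card \<Omega> = M"
      using fin by (simp add: \<Omega>_def M_def card_PiE card_cartesian_product V_def I_def power2_eq_square)
    have "s \<le> K * n" using n unfolding K_def by simp
    then have sumW: "sum W \<Omega> \<le> L * M"
      using sum_dense_subsets_le[of s K n] by (simp add: W_def[abs_def] \<Omega>_def V_def I_def L_def M_def)
    have "real (sum Z \<Omega>) \<le> 4 ^ n * ((1 - \<gamma>\<^sup>2) * n\<^sup>2) ^ (K * n)"
      using sum_empty_pairs_le[OF assms, where n = n and N = "K * n"]
      by (simp add: Z_def[abs_def] \<Omega>_def V_def I_def)
    also have "\<dots> = (4 * (1 - \<gamma>\<^sup>2) ^ K) ^ n * M"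
      by (simp add: M_def power_mult_distrib power_mult)
    also have "\<dots> \<le> (1 / 2) ^ n * M"
      using K \<open>\<gamma>\<^sup>2 \<le> 1\<close> by (intro mult_right_mono power_mono) auto
    also have "\<dots> \<le> (1 / 2) ^ n1 * M"
      using n by (intro mult_right_mono power_decreasing) auto
    also have "\<dots> < 1 / (L + 1) * M"
      using n1 \<open>M > 0\<close> by (intro mult_strict_right_mono) auto
    finally have "real (L + 1) * sum Z \<Omega> < M"
      by (simp add: field_simps)
    then have sumZ: "(L + 1) * sum Z \<Omega> < M"
      by (simp only: flip: of_nat_mult of_nat_less_iff[where 'a = real])
    \<comment> \<open>The weight forces \<open>Z e = 0\<close> and \<open>W e \<le> L\<close> at once.\<close>
    have "\<exists>e \<in> \<Omega>. W e + (L + 1) * Z e < L + 1"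
    proof (rule ccontr)
      assume "\<not> ?thesis"
      then have "(\<Sum>e \<in> \<Omega>. L + 1) \<le> (\<Sum>e \<in> \<Omega>. W e + (L + 1) * Z e)"
        by (intro sum_mono) auto
      then have "(L + 1) * M \<le> sum W \<Omega> + (L + 1) * sum Z \<Omega>"
        by (simp add: card sum.distrib sum_distrib_left[symmetric] mult.commute)
      with sumW sumZ show False by (simp add: mult.commute)
    qed
    then obtain e where e: "e \<in> \<Omega>" and "W e + (L + 1) * Z e < L + 1" by blast
    then have We: "W e \<le> L" and Ze: "Z e = 0"
      by (simp, cases "Z e") auto
    have finZ: "finite {(A, B). A \<subseteq> V \<and> B \<subseteq> V \<and> \<gamma> * n \<le> card A \<and> \<gamma> * n \<le> card B \<and> e ` I \<inter> A \<times> B = {}}"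
      by (rule finite_subset[of _ "Pow V \<times> Pow V"]) (use fin in auto)
    have finW: "finite {(S, J). S \<subseteq> V \<and> card S = s \<and> J \<subseteq> I \<and> card J = s \<and> e ` J \<subseteq> S \<times> S}"
      by (rule finite_subset[of _ "Pow V \<times> Pow I"]) (use fin in auto)
    \<comment> \<open>Every dense \<open>S\<close> has at least one witness: take \<open>s\<close>
      distinct sampled pairs inside \<open>S \<times> S\<close> and one index for each of
      them.\<close>
    have "{S. S \<subseteq> V \<and> card S = s \<and> s \<le> card (e ` I \<inter> S \<times> S)}
        \<subseteq> fst ` {(S, J). S \<subseteq> V \<and> card S = s \<and> J \<subseteq> I \<and> card J = s \<and> e ` J \<subseteq> S \<times> S}"
    proof
      fix S assume "S \<in> {S. S \<subseteq> V \<and> card S = s \<and> s \<le> card (e ` I \<inter> S \<times> S)}"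
      then have S: "S \<subseteq> V" "card S = s" "s \<le> card (e ` I \<inter> S \<times> S)" by auto
      from S(3) obtain F where F: "F \<subseteq> e ` I \<inter> S \<times> S" "card F = s"
        by (meson obtain_subset_with_card_n)
      then have "F \<subseteq> e ` I" by blast
      then obtain J where "J \<subseteq> I" "inj_on e J" "F = e ` J"
        by (auto simp: subset_image_inj)
      moreover from this F have "card J = s" by (simp add: card_image)
      ultimately have "(S, J) \<in> {(S, J). S \<subseteq> V \<and> card S = s \<and> J \<subseteq> I \<and> card J = s \<and> e ` J \<subseteq> S \<times> S}"
        using S F by simp
      then show "S \<in> fst ` {(S, J). S \<subseteq> V \<and> card S = s \<and> J \<subseteq> I \<and> card J = s \<and> e ` J \<subseteq> S \<times> S}"
        by (rule image_eqI[rotated]) simp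
    qed
    then have "card {S. S \<subseteq> V \<and> card S = s \<and> s \<le> card (e ` I \<inter> S \<times> S)} \<le> W e"
      unfolding W_def by (rule surj_card_le[OF finW])
    moreover have "e ` I \<inter> A \<times> B \<noteq> {}"
      if "A \<subseteq> V" "B \<subseteq> V" "\<gamma> * n \<le> card A" "\<gamma> * n \<le> card B" for A B
      using Ze finZ that unfolding Z_def by (auto simp: card_eq_0_iff)
    moreover have "e ` I \<subseteq> V \<times> V"
      using e by (auto simp: \<Omega>_def PiE_iff)
    ultimately show "\<exists>E \<subseteq> {..<n} \<times> {..<n}.
      card {S. S \<subseteq> {..<n} \<and> card S = s \<and> s \<le> card (E \<inter> S \<times> S)} \<le> L \<and>
      (\<forall>A B. A \<subseteq> {..<n} \<and> B \<subseteq> {..<n} \<and> \<gamma> * n \<le> card A \<and> \<gamma> * n \<le> card B \<longrightarrow> E \<inter> A \<times> B \<noteq> {})"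
      using We unfolding V_def by (intro exI[of _ "e ` I"]) auto
  qed
qed

section \<open>Copies of \<open>P7\<close> and their backward arcs\<close>

text \<open>Of an induced copy only an arc-preserving injection is kept, which is enough to
  transport arcs of \<open>H\<close> into \<open>G\<close>.\<close>

lemma not_free_ofE:
  assumes "\<not> free_of H G"
  obtains g where "inj_on g (pverts H)" "g ` pverts H \<subseteq> pverts G"
    "\<And>u v. (u, v) \<in> parcs H \<Longrightarrow> (g u, g v) \<in> parcs G"
proof -
  obtain K h where ind: "induced_subgraph K (with_proj G)"
    and iso: "pre_digraph.digraph_isomorphism K h" and H: "with_proj H = app_iso h K"
    using assms unfolding free_of_def digraph_iso_def by auto
  have vK: "verts K \<subseteq> pverts G" and aK: "arcs K \<subseteq> parcs G" and th: "tail K = fst" "head K = snd"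
    and wf: "wf_digraph K"
    using ind unfolding induced_subgraph_def subgraph_def compatible_def by auto
  have inj: "inj_on (iso_verts h) (verts K)"
    using iso unfolding pre_digraph.digraph_isomorphism_def by blast
  have vH: "pverts H = iso_verts h ` verts K" and aH: "parcs H = iso_arcs h ` arcs K"
    and ends: "\<And>a. a \<in> arcs K \<Longrightarrow> iso_verts h (fst a) = fst (iso_arcs h a) \<and> iso_verts h (snd a) = snd (iso_arcs h a)"
    using iso H unfolding pre_digraph.digraph_isomorphism_def th app_iso_def with_proj_def
    by auto
  \<comment> \<open>The isomorphism leads from the copy inside \<open>G\<close> to \<open>H\<close>;
    the embedding is its inverse.\<close>
  define g where "g = inv_into (verts K) (iso_verts h)"
  have "inj_on g (pverts H)"
    unfolding g_def vH by (rule inj_on_inv_into) simp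
  moreover have "g ` pverts H \<subseteq> pverts G"
    using vK inj by (auto simp: g_def vH)
  moreover have "(g u, g v) \<in> parcs G" if "(u, v) \<in> parcs H" for u v
  proof -
    from that obtain a where a: "a \<in> arcs K" "(u, v) = iso_arcs h a"
      unfolding aH by blast
    with ends[OF a(1)] have "u = iso_verts h (fst a)" "v = iso_verts h (snd a)"
      by (metis fst_conv, metis snd_conv)
    moreover have "fst a \<in> verts K" "snd a \<in> verts K"
      using wf_digraph.tail_in_verts[OF wf a(1)] wf_digraph.head_in_verts[OF wf a(1)] by (simp_all add: th)
    ultimately show ?thesis using inj a(1) aK by (auto simp: g_def)
  qed
  ultimately show thesis by (rule that)
qed

text \<open>
  The seven cyclic triangles on \<open>{i, i + 1, i + 3}\<close> partition the arcs of \<open>P7\<close>, and each of them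
  contains a backward arc.
\<close>

lemma seven_backward_arcs_P7:
  fixes g :: "int \<Rightarrow> 'a :: linorder"
  assumes inj: "inj_on g {1..7}"
    and arcs: "\<And>i j. (i, j) \<in> parcs P7 \<Longrightarrow> (g i, g j) \<in> R"
    and "finite R"
  shows "7 \<le> card {(u, v) \<in> R \<inter> g ` {1..7} \<times> g ` {1..7}. v < u}"
proof -
  \<comment> \<open>Residues are represented by 1 to 7. The triangles \<open>T i\<close> live on the
    translates of {0, 1, 3} modulo 7, the lines of the Fano plane; their arcs have differences 1, 2
    and 4.\<close>
  define w :: "int \<Rightarrow> int" where "w x = (x - 1) mod 7 + 1" for x
  define T where "T i = {(w i, w (i + 1)), (w (i + 1), w (i + 3)), (w (i + 3), w i)}" for i
  have range: "{1..7::int} = {1, 2, 3, 4, 5, 6, 7}" by auto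
  have T_simps: "T 1 = {(1, 2), (2, 4), (4, 1)}" "T 2 = {(2, 3), (3, 5), (5, 2)}"
    "T 3 = {(3, 4), (4, 6), (6, 3)}" "T 4 = {(4, 5), (5, 7), (7, 4)}" "T 5 = {(5, 6), (6, 1), (1, 5)}"
    "T 6 = {(6, 7), (7, 2), (2, 6)}" "T 7 = {(7, 1), (1, 3), (3, 7)}"
    by (simp_all add: T_def w_def)
  have T: "T i \<subseteq> parcs P7" if "i \<in> {1..7}" for i
    using that unfolding range by (auto simp: T_simps P7_def cong_def)
  \<comment> \<open>The difference along an arc shows its position in its triangle and thereby
    recovers \<open>i\<close>: the tail for difference 1, the predecessor of the tail for 2, the
    head for 4. Hence no arc lies in two triangles.\<close>
  define line where "line a = (let t = (snd a - fst a) mod 7 in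
      if t = 1 then fst a else if t = 2 then w (fst a - 1) else snd a)" for a
  have line: "line a = i" if "i \<in> {1..7}" "a \<in> T i" for i a
    using that unfolding range by (auto simp: T_simps line_def w_def)
  have w: "w x \<in> {1..7}" for x
    unfolding w_def using pos_mod_bound[of 7 "x - 1"] pos_mod_sign[of 7 "x - 1"] by auto
  \<comment> \<open>Without a backward arc, \<open>g\<close> would be nondecreasing all the way
    round the cycle, hence constant on it, against injectivity.\<close>
  have "\<exists>a \<in> T i. g (snd a) < g (fst a)" if "i \<in> {1..7}" for i
  proof (rule ccontr)
    assume "\<not> ?thesis"
    then have "g (w i) \<le> g (w (i + 1))" "g (w (i + 1)) \<le> g (w (i + 3))" "g (w (i + 3)) \<le> g (w i)"
      by (auto simp: T_def not_less)
    then have "g (w i) = g (w (i + 1))" by simp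
    then have "w i = w (i + 1)" using inj w by (auto dest: inj_onD)
    then show False using that unfolding range by (auto simp: w_def)
  qed
  then obtain b where b: "\<And>i. i \<in> {1..7} \<Longrightarrow> b i \<in> T i"
    and backward: "\<And>i. i \<in> {1..7} \<Longrightarrow> g (snd (b i)) < g (fst (b i))"
    by metis
  have verts: "fst (b i) \<in> {1..7}" "snd (b i) \<in> {1..7}" if "i \<in> {1..7}" for i
    using b[OF that] T[OF that] by (auto simp: P7_def)
  have "inj_on b {1..7}"
    using line b by (intro inj_onI) metis
  moreover have "inj_on (map_prod g g) (b ` {1..7})"
    by (rule map_prod_inj_on[OF inj inj, THEN inj_on_subset])
      (use verts in \<open>simp add: image_subset_iff mem_Times_iff\<close>)
  ultimately have "inj_on (map_prod g g \<circ> b) {1..7}"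
    by (rule comp_inj_on)
  then have "card ((map_prod g g \<circ> b) ` {1..7}) = card {1..7::int}"
    by (rule card_image)
  then have "7 = card ((map_prod g g \<circ> b) ` {1..7})"
    by (simp only:) simp
  also have "\<dots> \<le> card {(u, v) \<in> R \<inter> g ` {1..7} \<times> g ` {1..7}. v < u}"
  proof (rule card_mono)
    show "finite {(u, v) \<in> R \<inter> g ` {1..7} \<times> g ` {1..7}. v < u}"
      using \<open>finite R\<close> by (rule finite_subset[rotated]) auto
    show "(map_prod g g \<circ> b) ` {1..7} \<subseteq> {(u, v) \<in> R \<inter> g ` {1..7} \<times> g ` {1..7}. v < u}"
    proof
      fix x assume "x \<in> (map_prod g g \<circ> b) ` {1..7}"
      then obtain i where i: "i \<in> {1..7}" "x = (g (fst (b i)), g (snd (b i)))"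
        by (auto simp: map_prod_def split_beta)
      have "(fst (b i), snd (b i)) \<in> parcs P7" using b[OF i(1)] T[OF i(1)] by auto
      then show "x \<in> {(u, v) \<in> R \<inter> g ` {1..7} \<times> g ` {1..7}. v < u}"
        using arcs backward[OF i(1)] verts[OF i(1)] i(2) by auto
    qed
  qed
  finally show ?thesis .
qed

section \<open>Separating two sets along the ordering\<close>

text \<open>Cut at an \<open>m\<close> with exactly \<open>k\<close> elements of \<open>A\<close>
  below it. Either \<open>k\<close> elements of \<open>B\<close> lie at or above \<open>m\<close>,
  or \<open>k\<close> of them lie below; in the latter case the at least \<open>k\<close> remaining
  elements of \<open>A\<close> lie above those.\<close>

lemma obtain_separated_halves:
  fixes A B :: "nat set"
  assumes fin: "finite A" "finite B" and A: "2 * k \<le> card A" and B: "2 * k \<le> card B"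
    and disj: "A \<inter> B = {}"
  obtains A' B' where "A' \<subseteq> A" "B' \<subseteq> B" "card A' = k" "card B' = k"
    "(\<forall>a\<in>A'. \<forall>b\<in>B'. a < b) \<or> (\<forall>a\<in>A'. \<forall>b\<in>B'. b < a)"
proof -
  have "\<exists>m. k = card {a\<in>A. a < m}"
  proof -
    \<comment> \<open>Raising the threshold by one adds at most one element, so the least threshold
      reaching \<open>k\<close> hits it exactly.\<close>
    define m where "m = (LEAST m. k \<le> card {a\<in>A. a < m})"
    have "{a\<in>A. a < Suc (Max A)} = A"
      using fin by (auto simp: less_Suc_eq_le)
    then have ex: "k \<le> card {a\<in>A. a < Suc (Max A)}" using A by simp
    have "k \<le> card {a\<in>A. a < m}"
      unfolding m_def using ex by (rule LeastI)
    moreover have "card {a\<in>A. a < m} \<le> k"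
    proof (cases m)
      case (Suc m')
      then have "card {a\<in>A. a < m'} < k"
        using not_less_Least[of m' "\<lambda>m. k \<le> card {a\<in>A. a < m}"] by (simp add: m_def)
      moreover have "card {a\<in>A. a < m} \<le> card (insert m' {a\<in>A. a < m'})"
        using fin Suc by (intro card_mono) auto
      moreover have "\<dots> \<le> Suc (card {a\<in>A. a < m'})"
        by (rule card_insert_le_m1) auto
      ultimately show ?thesis by simp
    qed simp
    ultimately show ?thesis by (intro exI[of _ m]) simp
  qed
  then obtain m where m: "k = card {a\<in>A. a < m}" by blast
  show thesis
  proof (cases "k \<le> card {b\<in>B. m \<le> b}")
    case True
    then obtain B' where "B' \<subseteq> {b\<in>B. m \<le> b}" "card B' = k"
      by (meson obtain_subset_with_card_n)
    then show thesis
      using m by (intro that[of "{a\<in>A. a < m}" B']) fastforce+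
  next
    case False
    have "card B = card {b\<in>B. b < m} + card {b\<in>B. m \<le> b}"
      using fin by (subst card_Un_disjoint[symmetric]) (auto intro!: arg_cong[where f = card])
    with False B have "k \<le> card {b\<in>B. b < m}" by simp
    then obtain B' where B': "B' \<subseteq> {b\<in>B. b < m}" "card B' = k"
      by (meson obtain_subset_with_card_n)
    have "card A = card {a\<in>A. a < m} + card {a\<in>A. m \<le> a}"
      using fin by (subst card_Un_disjoint[symmetric]) (auto intro!: arg_cong[where f = card])
    with A m have "k \<le> card {a\<in>A. m \<le> a}" by simp
    then obtain A' where A': "A' \<subseteq> {a\<in>A. m \<le> a}" "card A' = k"
      by (meson obtain_subset_with_card_n)
    show thesis
      using A' B' by (intro that[of A' B']) fastforce+
  qed
qed

section \<open>Tournaments prescribed by their backward pairs\<close>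

text \<open>The arcs go upwards, except between vertices paired (in either order) by \<open>E\<close>.\<close>

definition back_tournament :: "nat set \<Rightarrow> (nat \<times> nat) set \<Rightarrow> nat pair_pre_digraph" where
  "back_tournament V E = \<lparr> pverts = V,
     parcs = {(u, v) \<in> V \<times> V. u \<noteq> v \<and> (u < v \<longleftrightarrow> (u, v) \<notin> E \<and> (v, u) \<notin> E)} \<rparr>"

lemma tournament_back_tournament:
  assumes "finite V"
  shows "tournament (back_tournament V E)"
proof
  show "finite (parcs (back_tournament V E))"
    by (rule finite_subset[of _ "V \<times> V"]) (use assms in \<open>auto simp: back_tournament_def\<close>)
qed (use assms in \<open>auto simp: back_tournament_def\<close>)

text \<open>A backward arc is charged to a pair in \<open>E\<close> joining its ends, in whichever
  order that pair occurs. As \<open>v < u\<close>, the arc can be read off from its pair, so the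
  charging is injective.\<close>

lemma card_backward_arcs_le:
  assumes "finite S"
  shows "card {(u, v) \<in> parcs (back_tournament V E) \<inter> S \<times> S. v < u} \<le> card (E \<inter> S \<times> S)"
proof (rule card_inj_on_le)
  define f where "f = (\<lambda>(u, v). if (u, v) \<in> E then (u, v) else (v, u :: nat))"
  show "inj_on f {(u, v) \<in> parcs (back_tournament V E) \<inter> S \<times> S. v < u}"
    by (auto simp: inj_on_def f_def split: if_splits)
  show "f ` {(u, v) \<in> parcs (back_tournament V E) \<inter> S \<times> S. v < u} \<subseteq> E \<inter> S \<times> S"
    by (auto simp: f_def back_tournament_def split: if_splits)
  show "finite (E \<inter> S \<times> S)" using assms by simp
qed

section \<open>The \<open>P7\<close>-free tournament without large pure pairs\<close>

theorem mainTheorem4: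
  shows "\<not> strong_EH P7"
proof
  assume "strong_EH P7"
  then obtain c :: real where "c > 0" and c: "\<And>G :: nat pair_pre_digraph.
      tournament G \<Longrightarrow> free_of P7 G \<Longrightarrow> card (pverts G) > 1 \<Longrightarrow>
      \<exists>A B. pure_pair G A B \<and> real (pair_order A B) \<ge> c * real (card (pverts G))"
    unfolding strong_EH_def by blast
  \<comment> \<open>The factor 8 pays for three losses of a factor 2: deleting up to half of the
    vertices, passing to halves of the pure pair, and rounding up in \<open>k\<close>. The minimum
    ensures \<open>\<gamma> \<le> 1\<close>.\<close>
  define \<gamma> where "\<gamma> = min c 1 / 8"
  have \<gamma>: "0 < \<gamma>" "\<gamma> \<le> 1" "8 * \<gamma> \<le> c" using \<open>c > 0\<close> by (auto simp: \<gamma>_def)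
  obtain L n0 :: nat where sparse: "\<And>n. n0 \<le> n \<Longrightarrow> \<exists>E \<subseteq> {..<n} \<times> {..<n}.
      card {S. S \<subseteq> {..<n} \<and> card S = 7 \<and> 7 \<le> card (E \<inter> S \<times> S)} \<le> L \<and>
      (\<forall>A B. A \<subseteq> {..<n} \<and> B \<subseteq> {..<n} \<and> \<gamma> * n \<le> card A \<and> \<gamma> * n \<le> card B \<longrightarrow> E \<inter> A \<times> B \<noteq> {})"
    by (rule exists_sparse_pairs[OF \<gamma>(1,2), where s = 7]) (rule that)
  \<comment> \<open>Here \<open>2 * L\<close> lets at least half of the vertices survive the
    deletion, \<open>4\<close> then leaves more than one vertex, and \<open>4 / \<gamma>\<close>
    makes the halves contain at least four vertices.\<close>
  define n where "n = Max {n0, 2 * L, 4, nat \<lceil>4 / \<gamma>\<rceil>}"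
  have n: "n0 \<le> n" "2 * L \<le> n" "4 \<le> n" "nat \<lceil>4 / \<gamma>\<rceil> \<le> n"
    unfolding n_def by (rule Max_ge; simp)+
  then have "4 / \<gamma> \<le> n" by linarith
  then have \<gamma>n: "4 \<le> \<gamma> * n" using \<gamma> by (simp add: field_simps)
  obtain E where few: "card {S. S \<subseteq> {..<n} \<and> card S = 7 \<and> 7 \<le> card (E \<inter> S \<times> S)} \<le> L"
    and "\<forall>A B. A \<subseteq> {..<n} \<and> B \<subseteq> {..<n} \<and> \<gamma> * n \<le> card A \<and> \<gamma> * n \<le> card B \<longrightarrow> E \<inter> A \<times> B \<noteq> {}"
    using sparse[OF n(1)] by (elim exE conjE) (rule that)
  then have dense: "E \<inter> A \<times> B \<noteq> {}"
    if "A \<subseteq> {..<n}" "B \<subseteq> {..<n}" "\<gamma> * n \<le> card A" "\<gamma> * n \<le> card B" for A B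
    using that by simp
  define \<S> where "\<S> = {S. S \<subseteq> {..<n} \<and> card S = 7 \<and> 7 \<le> card (E \<inter> S \<times> S)}"
  have "finite \<S>" by (rule finite_subset[of _ "Pow {..<n}"]) (auto simp: \<S>_def)
  define d where "d S = (SOME x. x \<in> S)" for S :: "nat set"
  have d: "d S \<in> S" if "S \<in> \<S>" for S
  proof -
    have "S \<noteq> {}" using that by (auto simp: \<S>_def)
    then show ?thesis by (simp add: d_def some_in_eq)
  qed
  \<comment> \<open>The survivors are not renumbered, so subsets of \<open>V\<close> with at least
    \<open>\<gamma> * n\<close> elements are still joined by \<open>E\<close>.\<close>
  define V where "V = {..<n} - d ` \<S>"
  define G where "G = back_tournament V E"
  have V: "V \<subseteq> {..<n}" "finite V" by (auto simp: V_def)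
  have pvG: "pverts G = V" by (simp add: G_def back_tournament_def)
  have finR: "finite (parcs G)"
    by (rule finite_subset[of _ "V \<times> V"]) (use V in \<open>auto simp: G_def back_tournament_def\<close>)
  have "card (d ` \<S>) \<le> L"
    using card_image_le[OF \<open>finite \<S>\<close>, of d] few by (simp add: \<S>_def)
  then have "n - L \<le> card V"
    using diff_card_le_card_Diff[of "d ` \<S>" "{..<n}"] \<open>finite \<S>\<close> by (simp add: V_def)
  then have cardV: "n \<le> 2 * card V" using n(2) by linarith
  \<comment> \<open>A dense 7-set has lost its vertex \<open>d S\<close>, so none lies inside
    \<open>V\<close>.\<close>
  have backward: "card {(u, v) \<in> parcs G \<inter> S \<times> S. v < u} < 7" if "S \<subseteq> V" "card S = 7" for S
  proof -
    have "S \<notin> \<S>" using d that(1) by (auto simp: V_def)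
    then have "card (E \<inter> S \<times> S) < 7" using that V by (auto simp: \<S>_def)
    moreover have "finite S" using that(1) V(2) by (rule finite_subset)
    ultimately show ?thesis
      using card_backward_arcs_le[of S V E] by (simp add: G_def)
  qed
  have "free_of P7 G"
  proof (rule ccontr)
    assume "\<not> free_of P7 G"
    then obtain g where g: "inj_on g (pverts P7)" "g ` pverts P7 \<subseteq> pverts G"
      "\<And>u v. (u, v) \<in> parcs P7 \<Longrightarrow> (g u, g v) \<in> parcs G"
      by (rule not_free_ofE) (rule that)
    have pv: "pverts P7 = {1..7}" by (simp add: P7_def)
    have "7 \<le> card {(u, v) \<in> parcs G \<inter> g ` {1..7} \<times> g ` {1..7}. v < u}"
      by (rule seven_backward_arcs_P7) (use g finR in \<open>auto simp: pv P7_def\<close>)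
    moreover have "card (g ` {1..7}) = 7" using g(1) by (simp add: card_image pv)
    ultimately show False using backward[of "g ` {1..7}"] g(2) by (simp add: pv pvG)
  qed
  moreover have "tournament G"
    unfolding G_def using V(2) by (rule tournament_back_tournament)
  moreover have "card (pverts G) > 1" using n(3) cardV by (simp add: pvG)
  ultimately obtain A B where pure: "pure_pair G A B" and order: "real (pair_order A B) \<ge> c * card V"
    using c[of G] by (auto simp: pvG)
  define k where "k = nat \<lceil>\<gamma> * n\<rceil>"
  have k: "\<gamma> * n \<le> k" "4 \<le> k" "real k \<le> \<gamma> * n + 1"
    using \<gamma>n unfolding k_def by linarith+
  have "2 * real k \<le> 4 * \<gamma> * n" using k(3) \<gamma>n by linarith
  also have "\<dots> \<le> 4 * \<gamma> * (2 * card V)"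
    using cardV \<gamma> by (intro mult_left_mono) linarith+
  also have "\<dots> \<le> c * card V"
    using mult_right_mono[OF \<gamma>(3), of "card V"] by simp
  also have "\<dots> \<le> pair_order A B" by (rule order)
  finally have "2 * k \<le> pair_order A B" by linarith
  then have halves: "2 * k \<le> card A" "2 * k \<le> card B" by (simp_all add: pair_order_def)
  have AB: "A \<subseteq> V" "B \<subseteq> V" "A \<inter> B = {}" "\<And>a b. a \<in> A \<Longrightarrow> b \<in> B \<Longrightarrow> (a, b) \<in> parcs G"
    using pure by (auto simp: pure_pair_def pvG)
  have fin: "finite A" "finite B" using AB V(2) finite_subset by blast+
  obtain A' B' where A'B': "A' \<subseteq> A" "B' \<subseteq> B" "card A' = k" "card B' = k"
    and sep: "(\<forall>a\<in>A'. \<forall>b\<in>B'. a < b) \<or> (\<forall>a\<in>A'. \<forall>b\<in>B'. b < a)"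
    by (rule obtain_separated_halves[OF fin halves AB(3)])
  from sep show False
  proof
    assume lt: "\<forall>a\<in>A'. \<forall>b\<in>B'. a < b"
    \<comment> \<open>A pair of \<open>E\<close> between the halves turns the arc between its ends
      backward, hence from \<open>B'\<close> to \<open>A'\<close>, against purity.\<close>
    have "E \<inter> A' \<times> B' \<noteq> {}"
      using A'B' AB V k(1) by (intro dense) auto
    then obtain a b where ab: "(a, b) \<in> E" "a \<in> A'" "b \<in> B'" by auto
    then have "(a, b) \<in> parcs G" "a < b" using AB(4) A'B' lt by auto
    with ab(1) show False by (simp add: G_def back_tournament_def)
  next
    assume gt: "\<forall>a\<in>A'. \<forall>b\<in>B'. b < a"
    \<comment> \<open>All arcs from \<open>X\<close> to \<open>Y\<close> are backward, and 3 * 4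
      exceeds the six allowed on seven vertices of \<open>V\<close>.\<close>
    obtain X where X: "X \<subseteq> A'" "card X = 3" "finite X"
      using obtain_subset_with_card_n[of 3 A'] A'B'(3) k(2) by auto
    obtain Y where Y: "Y \<subseteq> B'" "card Y = 4" "finite Y"
      using obtain_subset_with_card_n[of 4 B'] A'B'(4) k(2) by auto
    have "X \<inter> Y = {}" using X Y A'B' AB(3) by blast
    then have "card (X \<union> Y) = 7" using X Y by (simp add: card_Un_disjoint)
    moreover have "X \<union> Y \<subseteq> V" using X Y A'B' AB by blast
    ultimately have "card {(u, v) \<in> parcs G \<inter> (X \<union> Y) \<times> (X \<union> Y). v < u} < 7"
      using backward by blast
    moreover have "card (X \<times> Y) \<le> card {(u, v) \<in> parcs G \<inter> (X \<union> Y) \<times> (X \<union> Y). v < u}"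
    proof (rule card_mono)
      show "finite {(u, v) \<in> parcs G \<inter> (X \<union> Y) \<times> (X \<union> Y). v < u}"
        by (rule finite_subset[OF _ finR]) auto
      show "X \<times> Y \<subseteq> {(u, v) \<in> parcs G \<inter> (X \<union> Y) \<times> (X \<union> Y). v < u}"
        using X Y A'B' AB(4) gt by blast
    qed
    ultimately show False using X Y by (simp add: card_cartesian_product)
  qed
qed

end
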